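(* Let $N_\alpha$ and $N_\beta$ be independent homogeneous Poisson processes with rates $\lambda_\alpha>0$ and $\lambda_\beta>0$ respectively, and let $\hat N(t)=N_\alpha(N_\beta(t))$, $t>0$. Then for every $t>0$ and every integer $k\ge 0$, $$\Pr\{\hat N(t)=k\}=\frac{\lambda_\alpha^k}{k!}e^{-\lambda_\beta t}\sum_{r=0}^\infty \frac{e^{-\lambda_\alpha r}r^k(\lambda_\beta t)^r}{r!}=\frac{\lambda_\alpha^k}{k!}e^{-\lambda_\beta t(1-e^{-\lambda_\alpha})}\,\mathfrak{B}_k\!\left(\lambda_\beta t e^{-\lambda_\alpha}\right),$$ and the probability generating function of $\hat N(t)$ is $$\mathbb{E}u^{\hat N(t)}=e^{\lambda_\beta t\left(e^{\lambda_\alpha(u-1)}-1\right)},\qquad |u|\le 1.$$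
   Context: $\mathfrak{B}_k(x)=e^{-x}\sum_{r=0}^\infty \frac{r^kx^r}{r!}$ is the $k$th order Bell polynomial. Convention: $0^0=1$. Poisson processes start at $0$ at time $0$, and $N_\alpha(N_\beta(t))$ denotes $N_\alpha$ evaluated at the random time $N_\beta(t)$. *)

theory Defs
  imports "HOL-Probability.Probability"
begin

text \<open>
  Only the values \<open>N t\<close> for \<open>t \<ge> 0\<close> are constrained. Path properties are required
  almost surely; since the paths are almost surely nondecreasing, the truncated subtraction on
  \<^typ>\<open>nat\<close> agrees almost surely with the true increment.
\<close>

locale poisson_process = prob_space M
  for M :: "'a measure" and rate :: real and N :: "real \<Rightarrow> 'a \<Rightarrow> nat" +
  assumes rate_pos: "rate > 0"
    and measurable_process: "\<And>t. t \<ge> 0 \<Longrightarrow> N t \<in> measurable M (count_space UNIV)"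
    and start_zero: "AE \<omega> in M. N 0 \<omega> = 0"
    and counting_paths: "AE \<omega> in M. mono_on {0..} (\<lambda>t. N t \<omega>) \<and>
          (\<forall>t\<ge>0. continuous (at_right t) (\<lambda>s. N s \<omega>))"
    and independent_increments: "\<And>(n::nat) (s :: nat \<Rightarrow> real).
          0 \<le> s 0 \<Longrightarrow> (\<And>i. i < n \<Longrightarrow> s i < s (Suc i)) \<Longrightarrow>
          indep_vars (\<lambda>_. count_space UNIV) (\<lambda>i \<omega>. N (s (Suc i)) \<omega> - N (s i) \<omega>) {..<n}"
    and poisson_increments: "\<And>s t. 0 \<le> s \<Longrightarrow> s < t \<Longrightarrow>
          distr M (count_space UNIV) (\<lambda>\<omega>. N t \<omega> - N s \<omega>) = measure_pmf (poisson_pmf (rate * (t - s)))"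

text \<open>Independence of two whole processes, as random elements of the product space of paths on
  \<open>[0, \<infinity>)\<close>, and not merely of their values at fixed times.\<close>

definition indep_processes ::
  "'a measure \<Rightarrow> (real \<Rightarrow> 'a \<Rightarrow> nat) \<Rightarrow> (real \<Rightarrow> 'a \<Rightarrow> nat) \<Rightarrow> bool" where
  "indep_processes M X Y \<longleftrightarrow>
     prob_space.indep_var M
       (Pi\<^sub>M {0..} (\<lambda>_. count_space UNIV)) (\<lambda>\<omega>. \<lambda>t\<in>{0..}. X t \<omega>)
       (Pi\<^sub>M {0..} (\<lambda>_. count_space UNIV)) (\<lambda>\<omega>. \<lambda>t\<in>{0..}. Y t \<omega>)"

definition bell_poly :: "nat \<Rightarrow> real \<Rightarrow> real" where
  "bell_poly k x = exp (- x) * (\<Sum>r. real r ^ k * x ^ r / fact r)"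

definition time_changed ::
  "(real \<Rightarrow> 'a \<Rightarrow> nat) \<Rightarrow> (real \<Rightarrow> 'a \<Rightarrow> nat) \<Rightarrow> real \<Rightarrow> 'a \<Rightarrow> nat" where
  "time_changed X T t \<omega> = X (real (T t \<omega>)) \<omega>"

end

theory Submission
  imports Defs
begin

text \<open>
  Conditioning on \<open>N\<^sub>\<beta> t = r\<close>, which is independent of \<open>N\<^sub>\<alpha> r\<close>, turns both expectations of interest
  into Poisson mixtures: \<open>E g (N\<^sub>\<alpha> (N\<^sub>\<beta> t)) = \<Sum>r. E g (N\<^sub>\<alpha> r) * P (N\<^sub>\<beta> t = r)\<close> for bounded \<open>g\<close>.
  Taking the indicator of \<open>{k}\<close> for \<open>g\<close> gives the probability mass function, and
  taking \<open>u ^ n\<close> gives the generating function.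
\<close>

text \<open>Lets point probabilities enter the mixture formula as expectations of bounded
  functions.\<close>

lemma integral_indicator_singleton:
  "(\<integral>\<omega>. indicator {k} (X \<omega>) \<partial>M) = measure M {\<omega> \<in> space M. X \<omega> = k}"
proof -
  have "(\<integral>\<omega>. indicator {k} (X \<omega>) \<partial>M) = (\<integral>\<omega>. indicator {\<omega> \<in> space M. X \<omega> = k} \<omega> \<partial>M)"
    by (intro Bochner_Integration.integral_cong) (auto simp: indicator_def)
  also have "\<dots> = measure M ({\<omega> \<in> space M. X \<omega> = k} \<inter> space M)"
    by (rule Bochner_Integration.integral_indicator)
  also have "{\<omega> \<in> space M. X \<omega> = k} \<inter> space M = {\<omega> \<in> space M. X \<omega> = k}"
    by auto
  finally show ?thesis .
qed

text \<open>Pointwise, \<open>g (X (T \<omega>) \<omega>)\<close> is the sum over \<open>r\<close>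
  of \<open>g (X r \<omega>)\<close> times the indicator of \<open>T \<omega> = r\<close>.
  Independence factorises the expectation of each term, and boundedness of \<open>g\<close> allows
  summation and expectation to be exchanged. Each term involves a single index, so independence is
  asked for one \<open>X r\<close> at a time.\<close>

lemma (in prob_space) sums_expectation_random_index:
  fixes g :: "nat \<Rightarrow> 'c :: {real_normed_field, banach, second_countable_topology}"
    and X :: "nat \<Rightarrow> 'a \<Rightarrow> nat" and T :: "'a \<Rightarrow> nat"
  assumes indep: "\<And>r. indep_var (count_space UNIV) (X r) (count_space UNIV) T"
    and bound: "\<And>n. norm (g n) \<le> B"
  shows "(\<lambda>r. expectation (\<lambda>\<omega>. g (X r \<omega>)) * of_real (prob {\<omega> \<in> space M. T \<omega> = r}))
           sums expectation (\<lambda>\<omega>. g (X (T \<omega>) \<omega>))"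
proof -
  define f where "f r \<omega> = g (X r \<omega>) * of_real (indicator {r} (T \<omega>))" for r \<omega>
  have [measurable]: "X r \<in> measurable M (count_space UNIV)" "T \<in> measurable M (count_space UNIV)" for r
    using indep_var_rv1[OF indep] indep_var_rv2[OF indep] by auto
  have gX_int: "integrable M (\<lambda>\<omega>. g (X r \<omega>))" for r
    using bound by (intro integrable_const_bound[where B = B]) auto
  have ind_int: "integrable M (\<lambda>\<omega>. indicator {r} (T \<omega>) :: real)" for r
    by (intro integrable_const_bound[where B = 1]) (auto simp: indicator_def)
  have ind_int': "integrable M (\<lambda>\<omega>. of_real (indicator {r} (T \<omega>)) :: 'c)" for r
    using ind_int by (rule integrable_of_real)
  have indep': "indep_var borel (\<lambda>\<omega>. g (X r \<omega>)) borel (\<lambda>\<omega>. of_real (indicator {r} (T \<omega>)) :: 'c)" for r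
    using indep_var_compose[OF indep, of g borel "\<lambda>n. of_real (indicator {r} n)" borel r]
    by (simp add: comp_def)
  have f_int: "integrable M (f r)" for r
    unfolding f_def by (rule indep_var_integrable[OF indep' gX_int ind_int'])
  have f_eq: "expectation (f r) =
      expectation (\<lambda>\<omega>. g (X r \<omega>)) * of_real (prob {\<omega> \<in> space M. T \<omega> = r})" for r
    unfolding f_def indep_var_lebesgue_integral[OF indep' gX_int ind_int']
    by (simp only: integral_of_real[OF ind_int] integral_indicator_singleton)
  \<comment> \<open>For fixed \<open>\<omega>\<close> only the index \<open>r = T \<omega>\<close>
    contributes.\<close>
  have f_sums: "(\<lambda>r. f r \<omega>) sums g (X (T \<omega>) \<omega>)" for \<omega>
    using sums_finite[of "{T \<omega>}" "\<lambda>r. f r \<omega>"] by (simp add: f_def)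
  have norm_f_sum: "summable (\<lambda>r. norm (f r \<omega>))" for \<omega>
    by (rule summable_finite[of "{T \<omega>}"]) (auto simp: f_def)
  \<comment> \<open>The events \<open>T = r\<close> are disjoint, so countable additivity makes
    their probabilities summable.\<close>
  have prob_sum: "summable (\<lambda>r. prob {\<omega> \<in> space M. T \<omega> = r})"
    by (intro sums_summable[OF finite_measure_UNION]) (auto simp: disjoint_family_on_def)
  \<comment> \<open>The norm of \<open>f r\<close> is at most \<open>B\<close> on the event
    \<open>T = r\<close> and zero elsewhere, so its expectation is dominated by \<open>B\<close>
    times the probability of that event.\<close>
  have "summable (\<lambda>r. expectation (\<lambda>\<omega>. norm (f r \<omega>)))"
  proof (rule summable_comparison_test'[OF summable_mult[OF prob_sum, of B]])
    fix r
    have "expectation (\<lambda>\<omega>. norm (f r \<omega>)) \<le> expectation (\<lambda>\<omega>. B * indicator {r} (T \<omega>))"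
    proof (rule integral_mono)
      show "integrable M (\<lambda>\<omega>. B * indicator {r} (T \<omega>))"
        using ind_int by (rule integrable_mult_right)
    qed (use integrable_norm[OF f_int] bound in \<open>auto simp: f_def indicator_def\<close>)
    then show "norm (expectation (\<lambda>\<omega>. norm (f r \<omega>))) \<le> B * prob {\<omega> \<in> space M. T \<omega> = r}"
      by (simp add: integral_indicator_singleton)
  qed
  then have "(\<lambda>r. expectation (f r)) sums expectation (\<lambda>\<omega>. \<Sum>r. f r \<omega>)"
    using f_int norm_f_sum by (intro sums_integral) auto
  moreover have "(\<Sum>r. f r \<omega>) = g (X (T \<omega>) \<omega>)" for \<omega>
    using sums_unique[OF f_sums] by simp
  ultimately show ?thesis by (simp add: f_eq)
qed

text \<open>Written as a series against the mass function, the expectation is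
  \<open>exp (- r)\<close> times the exponential series at \<open>r * u\<close>.\<close>

lemma poisson_pmf_generating_function:
  fixes u :: complex
  assumes "0 < r" and "norm u \<le> 1"
  shows "measure_pmf.expectation (poisson_pmf r) (\<lambda>n. u ^ n) = exp (of_real r * (u - 1))"
proof -
  have "integrable (measure_pmf (poisson_pmf r)) (\<lambda>n. u ^ n)"
    using assms(2)
    by (intro measure_pmf.integrable_const_bound[where B = 1]) (auto simp: norm_power power_le_one)
  \<comment> \<open>The Poisson law has its mass function as density with respect to counting
    measure, which turns the integral into a series.\<close>
  then have "integrable (count_space UNIV) (\<lambda>n. pmf (poisson_pmf r) n *\<^sub>R u ^ n)"
    by (subst (asm) measure_pmf_eq_density) (simp add: integrable_density)
  from sums_integral_count_space_nat[OF this]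
  have "(\<lambda>n. pmf (poisson_pmf r) n *\<^sub>R u ^ n) sums
      measure_pmf.expectation (poisson_pmf r) (\<lambda>n. u ^ n)"
    by (subst measure_pmf_eq_density) (simp add: integral_density)
  moreover have "(\<lambda>n. of_real (exp (- r)) * ((of_real r * u) ^ n /\<^sub>R fact n)) sums
      (of_real (exp (- r)) * exp (of_real r * u))"
    by (intro sums_mult exp_converges)
  ultimately have "measure_pmf.expectation (poisson_pmf r) (\<lambda>n. u ^ n) =
      of_real (exp (- r)) * exp (of_real r * u)"
    using assms(1) by (intro sums_unique2) (simp_all add: scaleR_conv_of_real field_simps)
  \<comment> \<open>The real factor is rewritten as a complex exponential so that the two exponents
    can be added.\<close>
  then show ?thesis
    by (simp add: exp_of_real[symmetric] exp_add[symmetric] algebra_simps del: exp_of_real)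
qed

text \<open>Almost surely \<open>N 0\<close> vanishes, so \<open>N t\<close> coincides with the
  increment over \<open>[0, t]\<close>.\<close>

lemma (in poisson_process) distr_eq_poisson:
  assumes "0 < t"
  shows "distr M (count_space UNIV) (N t) = measure_pmf (poisson_pmf (rate * t))"
proof -
  note [measurable] = measurable_process[of t] measurable_process[of 0]
  have "distr M (count_space UNIV) (N t) = distr M (count_space UNIV) (\<lambda>\<omega>. N t \<omega> - N 0 \<omega>)"
    using assms start_zero by (intro distr_cong_AE) auto
  also have "\<dots> = measure_pmf (poisson_pmf (rate * t))"
    using poisson_increments[of 0 t] assms by simp
  finally show ?thesis .
qed

lemma (in poisson_process) expectation_eq_poisson:
  fixes g :: "nat \<Rightarrow> 'c :: {banach, second_countable_topology}"
  assumes "0 < t"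
  shows "expectation (\<lambda>\<omega>. g (N t \<omega>)) = measure_pmf.expectation (poisson_pmf (rate * t)) g"
  using measurable_process[of t] assms
  by (simp add: distr_eq_poisson[symmetric] integral_distr)

text \<open>Covers time \<open>0\<close>, which the law of increments over intervals of positive
  length does not reach. The case does occur: the inner process takes the value \<open>0\<close>
  with positive probability.\<close>

lemma (in poisson_process) expectation_start:
  fixes g :: "nat \<Rightarrow> 'c :: {banach, second_countable_topology}"
  shows "expectation (\<lambda>\<omega>. g (N 0 \<omega>)) = g 0"
proof -
  note [measurable] = measurable_process[of 0]
  have "expectation (\<lambda>\<omega>. g (N 0 \<omega>)) = expectation (\<lambda>\<omega>. g 0)"
    using start_zero by (intro integral_cong_AE) auto
  then show ?thesis by (simp add: prob_space)
qed

lemma (in poisson_process) prob_eq: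
  assumes "0 \<le> t"
  shows "prob {\<omega> \<in> space M. N t \<omega> = k} = (rate * t) ^ k / fact k * exp (- (rate * t))"
proof -
  have "prob {\<omega> \<in> space M. N t \<omega> = k} = expectation (\<lambda>\<omega>. indicator {k} (N t \<omega>))"
    by (rule integral_indicator_singleton[symmetric])
  also have "\<dots> = (rate * t) ^ k / fact k * exp (- (rate * t))"
  proof (cases "t = 0")
    case True
    \<comment> \<open>With \<open>0 ^ 0 = 1\<close> the Poisson formula at \<open>t = 0\<close> is
      the point mass at \<open>0\<close>.\<close>
    then show ?thesis by (cases k) (simp_all add: expectation_start)
  next
    case False
    then show ?thesis
      using assms rate_pos by (simp add: expectation_eq_poisson measure_pmf_single)
  qed
  finally show ?thesis .
qed

lemma (in poisson_process) generating_function: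
  fixes u :: complex
  assumes "0 \<le> t" and "norm u \<le> 1"
  shows "expectation (\<lambda>\<omega>. u ^ N t \<omega>) = exp (of_real (rate * t) * (u - 1))"
proof (cases "t = 0")
  case True
  then show ?thesis by (simp add: expectation_start)
next
  case False
  then show ?thesis
    using assms rate_pos
      expectation_eq_poisson[of t "\<lambda>n. u ^ n"] poisson_pmf_generating_function[of "rate * t" u]
    by simp
qed

text \<open>Evaluation at a time in \<open>{0..}\<close> is a measurable coordinate projection of
  the path space, and independence survives composition with measurable maps.\<close>

lemma (in prob_space) indep_processes_marginals:
  assumes "indep_processes M X Y" and "0 \<le> s" and "0 \<le> t"
  shows "indep_var (count_space UNIV) (X s) (count_space UNIV) (Y t)"
  using indep_var_compose[OF assms(1)[unfolded indep_processes_def],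
      of "\<lambda>p. p s" "count_space UNIV" "\<lambda>p. p t" "count_space UNIV"] assms(2,3)
  by (simp add: comp_def)

text \<open>The inner process is integer-valued, so the outer one is only evaluated at times
  \<open>real r\<close>; the weights are the Poisson probabilities of \<open>Y t\<close>.\<close>

lemma sums_expectation_time_changed:
  fixes g :: "nat \<Rightarrow> 'c :: {real_normed_field, banach, second_countable_topology}"
  assumes "poisson_process M b Y" and "indep_processes M X Y"
    and "0 \<le> t" and "\<And>n. norm (g n) \<le> B"
  shows "(\<lambda>r. prob_space.expectation M (\<lambda>\<omega>. g (X (real r) \<omega>)) *
             of_real ((b * t) ^ r / fact r * exp (- (b * t))))
           sums prob_space.expectation M (\<lambda>\<omega>. g (time_changed X Y t \<omega>))"
proof -
  interpret poisson_process M b Y by fact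
  show ?thesis
    using sums_expectation_random_index[where X = "\<lambda>r. X (real r)" and T = "Y t" and g = g and B = B] assms
    by (simp add: indep_processes_marginals prob_eq time_changed_def)
qed

theorem theorem2p1:
  fixes M :: "'a measure" and N\<^sub>\<alpha> N\<^sub>\<beta> :: "real \<Rightarrow> 'a \<Rightarrow> nat" and rate\<^sub>\<alpha> rate\<^sub>\<beta> t :: real
  assumes "rate\<^sub>\<alpha> > 0" and "rate\<^sub>\<beta> > 0"
    and "poisson_process M rate\<^sub>\<alpha> N\<^sub>\<alpha>" and "poisson_process M rate\<^sub>\<beta> N\<^sub>\<beta>"
    and "indep_processes M N\<^sub>\<alpha> N\<^sub>\<beta>"
    and "t > 0"
  shows "(\<forall>k::nat.
            measure M {\<omega> \<in> space M. time_changed N\<^sub>\<alpha> N\<^sub>\<beta> t \<omega> = k} =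
              rate\<^sub>\<alpha> ^ k / fact k * exp (- rate\<^sub>\<beta> * t) *
              (\<Sum>r. exp (- rate\<^sub>\<alpha> * real r) * real r ^ k * (rate\<^sub>\<beta> * t) ^ r / fact r) \<and>
            rate\<^sub>\<alpha> ^ k / fact k * exp (- rate\<^sub>\<beta> * t) *
              (\<Sum>r. exp (- rate\<^sub>\<alpha> * real r) * real r ^ k * (rate\<^sub>\<beta> * t) ^ r / fact r) =
              rate\<^sub>\<alpha> ^ k / fact k * exp (- rate\<^sub>\<beta> * t * (1 - exp (- rate\<^sub>\<alpha>))) *
              bell_poly k (rate\<^sub>\<beta> * t * exp (- rate\<^sub>\<alpha>))) \<and>
         (\<forall>u::complex. norm u \<le> 1 \<longrightarrow>
            prob_space.expectation M (\<lambda>\<omega>. u ^ time_changed N\<^sub>\<alpha> N\<^sub>\<beta> t \<omega>) =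
              exp (of_real (rate\<^sub>\<beta> * t) * (exp (of_real rate\<^sub>\<alpha> * (u - 1)) - 1)))"
proof -
  interpret A: poisson_process M rate\<^sub>\<alpha> N\<^sub>\<alpha> by fact
  let ?N = "time_changed N\<^sub>\<alpha> N\<^sub>\<beta> t"
  let ?m = "rate\<^sub>\<beta> * t"
  note mixture = sums_expectation_time_changed[OF assms(4,5) less_imp_le[OF \<open>t > 0\<close>]]
  have pmf: "measure M {\<omega> \<in> space M. ?N \<omega> = k} =
      rate\<^sub>\<alpha> ^ k / fact k * exp (- rate\<^sub>\<beta> * t) *
      (\<Sum>r. exp (- rate\<^sub>\<alpha> * real r) * real r ^ k * ?m ^ r / fact r)" for k
  proof -
    have "(\<lambda>r. (rate\<^sub>\<alpha> * real r) ^ k / fact k * exp (- (rate\<^sub>\<alpha> * real r)) *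
        (?m ^ r / fact r * exp (- ?m))) sums measure M {\<omega> \<in> space M. ?N \<omega> = k}"
      using mixture[of "indicator {k} :: nat \<Rightarrow> real" 1]
      unfolding integral_indicator_singleton by (simp add: A.prob_eq)
    then have "(\<lambda>r. rate\<^sub>\<alpha> ^ k / fact k * exp (- rate\<^sub>\<beta> * t) *
        (exp (- rate\<^sub>\<alpha> * real r) * real r ^ k * ?m ^ r / fact r))
        sums measure M {\<omega> \<in> space M. ?N \<omega> = k}"
      by (simp add: power_mult_distrib mult_ac)
    \<comment> \<open>Cancelling a nonzero constant factor from the convergent series also yields
      convergence of the series in the claim.\<close>
    moreover have "rate\<^sub>\<alpha> ^ k / fact k * exp (- rate\<^sub>\<beta> * t) \<noteq> 0"
      using \<open>rate\<^sub>\<alpha> > 0\<close> by simp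
    ultimately have "(\<lambda>r. exp (- rate\<^sub>\<alpha> * real r) * real r ^ k * ?m ^ r / fact r) sums
        (measure M {\<omega> \<in> space M. ?N \<omega> = k} / (rate\<^sub>\<alpha> ^ k / fact k * exp (- rate\<^sub>\<beta> * t)))"
      by (rule sums_mult_D)
    from sums_unique[OF this] show ?thesis
      using \<open>rate\<^sub>\<alpha> > 0\<close> by (simp add: field_simps)
  qed
  have bell: "rate\<^sub>\<alpha> ^ k / fact k * exp (- rate\<^sub>\<beta> * t) *
      (\<Sum>r. exp (- rate\<^sub>\<alpha> * real r) * real r ^ k * ?m ^ r / fact r) =
      rate\<^sub>\<alpha> ^ k / fact k * exp (- rate\<^sub>\<beta> * t * (1 - exp (- rate\<^sub>\<alpha>))) *
      bell_poly k (?m * exp (- rate\<^sub>\<alpha>))" for k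
  proof -
    \<comment> \<open>The factor \<open>exp (- rate\<^sub>\<alpha> * real r)\<close> is the
      \<open>r\<close>-th power of \<open>exp (- rate\<^sub>\<alpha>)\<close> and is absorbed into
      the argument of the Bell polynomial.\<close>
    have "exp (- rate\<^sub>\<alpha> * real r) * real r ^ k * ?m ^ r / fact r =
        real r ^ k * (?m * exp (- rate\<^sub>\<alpha>)) ^ r / fact r" for r
      using exp_of_nat2_mult[of "- rate\<^sub>\<alpha>" r] by (simp add: power_mult_distrib)
    \<comment> \<open>The second exponential on the right is the normalising factor in
      \<open>bell_poly\<close>.\<close>
    moreover have "exp (- rate\<^sub>\<beta> * t) =
        exp (- rate\<^sub>\<beta> * t * (1 - exp (- rate\<^sub>\<alpha>))) * exp (- (?m * exp (- rate\<^sub>\<alpha>)))"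
      by (simp add: exp_add[symmetric] algebra_simps)
    ultimately show ?thesis unfolding bell_poly_def by (simp only: mult.assoc)
  qed
  have pgf: "A.expectation (\<lambda>\<omega>. u ^ ?N \<omega>) =
      exp (of_real ?m * (exp (of_real rate\<^sub>\<alpha> * (u - 1)) - 1))"
    if u: "norm u \<le> 1" for u :: complex
  proof -
    let ?e = "exp (of_real rate\<^sub>\<alpha> * (u - 1)) :: complex"
    \<comment> \<open>The exponent is linear in time, so the generating function at time
      \<open>r\<close> is the \<open>r\<close>-th power of the one at time \<open>1\<close>. The
      mixture then becomes an exponential series in \<open>?m * ?e\<close>, that is, the Poisson
      generating function of the inner process evaluated at \<open>?e\<close>.\<close>
    have "A.expectation (\<lambda>\<omega>. u ^ N\<^sub>\<alpha> (real r) \<omega>) = ?e ^ r" for r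
      using u by (simp add: A.generating_function exp_of_nat_mult[symmetric] mult_ac)
    then have "(\<lambda>r. ?e ^ r * of_real (?m ^ r / fact r * exp (- ?m))) sums
        A.expectation (\<lambda>\<omega>. u ^ ?N \<omega>)"
      using mixture[of "\<lambda>n. u ^ n" 1] u by (simp add: norm_power power_le_one)
    moreover have "(\<lambda>r. of_real (exp (- ?m)) * ((of_real ?m * ?e) ^ r /\<^sub>R fact r)) sums
        (of_real (exp (- ?m)) * exp (of_real ?m * ?e))"
      by (intro sums_mult exp_converges)
    ultimately have "A.expectation (\<lambda>\<omega>. u ^ ?N \<omega>) = of_real (exp (- ?m)) * exp (of_real ?m * ?e)"
      by (intro sums_unique2) (simp_all add: scaleR_conv_of_real field_simps)
    then show ?thesis
      by (simp add: exp_of_real[symmetric] exp_add[symmetric] algebra_simps del: exp_of_real)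
  qed
  show ?thesis
    using pmf bell pgf by blast
qed

end
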